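(* Let $\alpha : I \subset \mathbb{R} \to \mathbb{E}^4$ be a unit speed curve with Frenet frame $\{T, N, B_1, B_2\}$ and principal curvature functions $\kappa, \tau, \sigma$ with respect to the Frenet frame, and let $\{T, M_1, M_2, M_3\}$ be the parallel transport frame of $\alpha$, with curvature functions $k_1, k_2, k_3$ with respect to the parallel transport frame. Then the relation between the two frames may be expressed, by means of angle functions $\theta(s), \phi(s), \psi(s)$, as $$T = T(s),$$ $$N = \cos\theta\cos\psi\, M_1 + (-\cos\phi\sin\psi + \sin\phi\sin\theta\cos\psi)\, M_2 + (\sin\phi\sin\psi + \cos\phi\sin\theta\cos\psi)\, M_3,$$ $$B_1 = \cos\theta\sin\psi\, M_1 + (\cos\phi\cos\psi + \sin\phi\sin\theta\sin\psi)\, M_2 + (-\sin\phi\cos\psi + \cos\phi\sin\theta\sin\psi)\, M_3,$$ $$B_2 = -\sin\theta\, M_1 + \sin\phi\cos\theta\, M_2 + \cos\phi\cos\theta\, M_3.$$ The parallel transport frame satisfies $$T' = k_1 M_1 + k_2 M_2 + k_3 M_3,\qquad M_1' = -k_1 T,\qquad M_2' = -k_2 T,\qquad M_3' = -k_3 T,$$ where $$k_1 = \kappa\cos\theta\cos\psi,$$ $$k_2 = \kappa(-\cos\phi\sin\psi + \sin\phi\sin\theta\cos\psi),$$ $$k_3 = \kappa(\sin\phi\sin\psi + \cos\phi\sin\theta\cos\psi),$$ with $$\theta' = \frac{\sigma}{\sqrt{\kappa^2+\tau^2}},\qquad \psi' = -\tau - \sigma\,\frac{\sqrt{\sigma^2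 - \theta'^2}}{\sqrt{\kappa^2+\tau^2}},\qquad \phi' = -\frac{\sqrt{\sigma^2-\theta'^2}}{\cos\theta},$$ and the following equalities hold: $$\kappa = \sqrt{k_1^2 + k_2^2 + k_3^2},\qquad \tau = -\psi' + \phi'\sin\theta,\qquad \sigma = \frac{\theta'}{\sin\psi},\qquad \phi'\cos\theta + \theta'\cot\psi = 0.$$
   Context: $\mathbb{E}^4$ is $\mathbb{R}^4$ with the standard inner product $\langle\cdot,\cdot\rangle$; primes denote derivatives with respect to the arclength parameter $s$, and curves are sufficiently differentiable. The Frenet frame $\{T,N,B_1,B_2\}$ of a unit speed curve $\alpha$ (tangent, principal normal, first and second binormal) is the orthonormal frame satisfying $T' = \kappa N$, $N' = -\kappa T + \tau B_1$, $B_1' = -\tau N + \sigma B_2$, $B_2' = -\sigma B_1$, where $\kappa,\tau,\sigma$ are the principal curvature functions. A vector field along $\alpha$ that is perpendicular to $T$ is called relatively parallel if its derivative is tangential (a multiple of $T$) along $\alpha$. A parallel transport frame of $\alpha$ is an orthonormal frame $\{T, M_1, M_2, M_3\}$ along $\alpha$ with $T=\alpha'$ and $M_1, M_2, M_3$ relatively parallel; its curvatures are $k_i = \langle T', M_i\rangle$, $i=1,2,3$.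
   Formalization: The formulas for θ', ψ', φ' fail in general (e.g. κ=τ=σ=1/2); proved is exactly when they hold, where cos θ≠0. Frames are equally oriented, κ>0, I is open; differentiable angles are asserted if B_2 is never ±M_1; formulas dividing by sin ψ where sin ψ≠0. *)

theory Defs
  imports "HOL-Analysis.Analysis"
begin

type_synonym E4 = "real ^ 4"

definition unit_speed_curve :: "real set \<Rightarrow> (real \<Rightarrow> E4) \<Rightarrow> bool" where
  "unit_speed_curve I \<alpha> \<longleftrightarrow>
     (\<forall>s\<in>I. \<alpha> differentiable (at s) \<and> norm (vector_derivative \<alpha> (at s)) = 1)"

definition orthonormal4 :: "E4 \<Rightarrow> E4 \<Rightarrow> E4 \<Rightarrow> E4 \<Rightarrow> bool" where
  "orthonormal4 a b c d \<longleftrightarrow>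
     norm a = 1 \<and> norm b = 1 \<and> norm c = 1 \<and> norm d = 1 \<and>
     a \<bullet> b = 0 \<and> a \<bullet> c = 0 \<and> a \<bullet> d = 0 \<and> b \<bullet> c = 0 \<and> b \<bullet> d = 0 \<and> c \<bullet> d = 0"

definition same_orientation ::
  "E4 \<Rightarrow> E4 \<Rightarrow> E4 \<Rightarrow> E4 \<Rightarrow> E4 \<Rightarrow> E4 \<Rightarrow> E4 \<Rightarrow> E4 \<Rightarrow> bool" where
  "same_orientation a b c d a' b' c' d' \<longleftrightarrow>
     0 < det (vector [a, b, c, d] :: real ^ 4 ^ 4) * det (vector [a', b', c', d'] :: real ^ 4 ^ 4)"

(* Positivity of the first curvature says that N is the principal normal T' / |T'|.
   No sign is prescribed for the second and third curvature. *)
definition frenet_frame ::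
  "real set \<Rightarrow> (real \<Rightarrow> E4) \<Rightarrow> (real \<Rightarrow> E4) \<Rightarrow> (real \<Rightarrow> E4) \<Rightarrow> (real \<Rightarrow> E4) \<Rightarrow> (real \<Rightarrow> E4) \<Rightarrow>
   (real \<Rightarrow> real) \<Rightarrow> (real \<Rightarrow> real) \<Rightarrow> (real \<Rightarrow> real) \<Rightarrow> bool" where
  "frenet_frame I \<alpha> T N B1 B2 \<kappa> \<tau> \<sigma> \<longleftrightarrow>
     (\<forall>s\<in>I.
        (\<alpha> has_vector_derivative T s) (at s) \<and>
        orthonormal4 (T s) (N s) (B1 s) (B2 s) \<and>
        0 < \<kappa> s \<and>
        (T has_vector_derivative \<kappa> s *\<^sub>R N s) (at s) \<and>
        (N has_vector_derivative - \<kappa> s *\<^sub>R T s + \<tau> s *\<^sub>R B1 s) (at s) \<and>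
        (B1 has_vector_derivative - \<tau> s *\<^sub>R N s + \<sigma> s *\<^sub>R B2 s) (at s) \<and>
        (B2 has_vector_derivative - \<sigma> s *\<^sub>R B1 s) (at s))"

definition relatively_parallel ::
  "real set \<Rightarrow> (real \<Rightarrow> E4) \<Rightarrow> (real \<Rightarrow> E4) \<Rightarrow> bool" where
  "relatively_parallel I T M \<longleftrightarrow>
     (\<forall>s\<in>I. M s \<bullet> T s = 0 \<and> (\<exists>c. (M has_vector_derivative c *\<^sub>R T s) (at s)))"

definition parallel_transport_frame ::
  "real set \<Rightarrow> (real \<Rightarrow> E4) \<Rightarrow> (real \<Rightarrow> E4) \<Rightarrow> (real \<Rightarrow> E4) \<Rightarrow> (real \<Rightarrow> E4) \<Rightarrow> (real \<Rightarrow> E4) \<Rightarrow> bool" where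
  "parallel_transport_frame I \<alpha> T M1 M2 M3 \<longleftrightarrow>
     (\<forall>s\<in>I. (\<alpha> has_vector_derivative T s) (at s) \<and> orthonormal4 (T s) (M1 s) (M2 s) (M3 s)) \<and>
     relatively_parallel I T M1 \<and> relatively_parallel I T M2 \<and> relatively_parallel I T M3"

(* The matrix taking (m1, m2, m3) to (n, b1, b2) is Rz(psi) Ry(theta) Rx(phi). *)
definition related_by_angles ::
  "real \<Rightarrow> real \<Rightarrow> real \<Rightarrow> E4 \<Rightarrow> E4 \<Rightarrow> E4 \<Rightarrow> E4 \<Rightarrow> E4 \<Rightarrow> E4 \<Rightarrow> bool" where
  "related_by_angles \<theta> \<phi> \<psi> n b1 b2 m1 m2 m3 \<longleftrightarrow>
     n = (cos \<theta> * cos \<psi>) *\<^sub>R m1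
         + (- cos \<phi> * sin \<psi> + sin \<phi> * sin \<theta> * cos \<psi>) *\<^sub>R m2
         + (sin \<phi> * sin \<psi> + cos \<phi> * sin \<theta> * cos \<psi>) *\<^sub>R m3 \<and>
     b1 = (cos \<theta> * sin \<psi>) *\<^sub>R m1
         + (cos \<phi> * cos \<psi> + sin \<phi> * sin \<theta> * sin \<psi>) *\<^sub>R m2
         + (- sin \<phi> * cos \<psi> + cos \<phi> * sin \<theta> * sin \<psi>) *\<^sub>R m3 \<and>
     b2 = (- sin \<theta>) *\<^sub>R m1 + (sin \<phi> * cos \<theta>) *\<^sub>R m2 + (cos \<phi> * cos \<theta>) *\<^sub>R m3"

end

theory Submission
  imports Defs
begin

text \<open>
  The inner products of \<open>N, B\<^sub>1, B\<^sub>2\<close> with \<open>M\<^sub>1, M\<^sub>2, M\<^sub>3\<close> form a 3 by 3 matrix, which is a rotation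
  because both frames share \<open>T\<close> and have the same orientation. Since \<open>M\<^sub>i'\<close> is tangential, the rows of
  this matrix satisfy the Frenet equations without the \<open>T\<close> terms. Substituting Euler angles into the
  row of \<open>B\<^sub>2\<close> gives \<open>\<theta>' = \<sigma> sin \<psi>\<close> and \<open>\<phi>' cos \<theta> = - \<sigma> cos \<psi>\<close>, also where \<open>cos \<theta> = 0\<close>, and the
  row of \<open>N\<close> gives \<open>\<tau> = - \<psi>' + \<phi>' sin \<theta>\<close>; the remaining formulas are algebraic consequences.
  If \<open>B\<^sub>2\<close> never meets \<open>\<plusminus>M\<^sub>1\<close>, then \<open>\<theta> = arcsin (- \<langle>B\<^sub>2, M\<^sub>1\<rangle>)\<close> is differentiable with \<open>cos \<theta> > 0\<close>,
  and \<open>\<phi>, \<psi>\<close> are obtained by lifting differentiable maps into the unit circle.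
\<close>

section \<open>Orthonormal frames and determinants in four dimensions\<close>

lemma vector_4 [simp]:
  "(vector [x, y, z, w] :: 'a::zero ^ 4) $ 1 = x"
  "(vector [x, y, z, w] :: 'a ^ 4) $ 2 = y"
  "(vector [x, y, z, w] :: 'a ^ 4) $ 3 = z"
  "(vector [x, y, z, w] :: 'a ^ 4) $ 4 = w"
  unfolding vector_def by simp_all

text \<open>Laplace expansion along a first row \<open>(1, 0, 0, 0)\<close>: what remains is the
  determinant of the lower right 3 by 3 block. The matrix of inner products between two orthonormal
  frames with the same first vector has this shape.\<close>

lemma det_4_first_row:
  fixes A :: "'a::comm_ring_1 ^ 4 ^ 4"
  assumes "A $ 1 $ 1 = 1" "A $ 1 $ 2 = 0" "A $ 1 $ 3 = 0" "A $ 1 $ 4 = 0"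
  shows "det A =
     A$2$2 * A$3$3 * A$4$4 + A$2$3 * A$3$4 * A$4$2 + A$2$4 * A$3$2 * A$4$3
   - A$2$2 * A$3$4 * A$4$3 - A$2$3 * A$3$2 * A$4$4 - A$2$4 * A$3$3 * A$4$2"
proof -
  have f1234: "finite {2::4, 3, 4}" "1 \<notin> {2::4, 3, 4}" by auto
  have f234: "finite {3::4, 4}" "2 \<notin> {3::4, 4}" by auto
  have f34: "finite {4::4}" "3 \<notin> {4::4}" by auto
  show ?thesis
    unfolding det_def UNIV_4
    unfolding sum_over_permutations_insert[OF f1234]
    unfolding sum_over_permutations_insert[OF f234]
    unfolding sum_over_permutations_insert[OF f34]
    unfolding permutes_sing
    by (simp add: assms sign_swap_id permutation_swap_id sign_compose sign_id algebra_simps)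
qed

lemma orthonormal4_matrix:
  assumes "orthonormal4 a b c d"
  shows "orthogonal_matrix (vector [a, b, c, d] :: real ^ 4 ^ 4)"
proof -
  let ?A = "vector [a, b, c, d] :: real ^ 4 ^ 4"
  have "(?A ** transpose ?A) $ i $ j = (?A $ i) \<bullet> (?A $ j)" for i j
    by (simp add: matrix_matrix_mult_def transpose_def inner_vec_def)
  then have "?A ** transpose ?A = mat 1"
    using assms
    by (simp add: vec_eq_iff forall_4 mat_def orthonormal4_def dot_square_norm inner_commute)
  then show ?thesis
    using orthogonal_matrix_def matrix_left_right_inverse by blast
qed

text \<open>With the frame as the rows of an orthogonal matrix \<open>A\<close>, the vector
  \<open>A *v x\<close> lists the inner products of \<open>x\<close> with the frame, and
  \<open>transpose A\<close> turns this list into a combination of the rows. The two matrices are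
  inverse to each other.\<close>

lemma orthonormal4_expand:
  assumes "orthonormal4 a b c d"
  shows "x = (x \<bullet> a) *\<^sub>R a + (x \<bullet> b) *\<^sub>R b + (x \<bullet> c) *\<^sub>R c + (x \<bullet> d) *\<^sub>R d"
proof -
  let ?A = "vector [a, b, c, d] :: real ^ 4 ^ 4"
  have "transpose ?A *v (?A *v x) = x"
    using orthonormal4_matrix[OF assms]
    by (simp add: orthogonal_matrix_def matrix_vector_mul_assoc)
  moreover have "transpose ?A *v y =
      y $ 1 *\<^sub>R a + y $ 2 *\<^sub>R b + y $ 3 *\<^sub>R c + y $ 4 *\<^sub>R d" for y
    by (simp add: vec_eq_iff matrix_vector_mult_def transpose_def sum_4 mult.commute)
  moreover have "(?A *v x) $ i = x \<bullet> ?A $ i" for i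
    by (simp add: matrix_mult_dot inner_commute)
  ultimately show ?thesis by simp
qed

section \<open>Lifting maps into the unit circle\<close>

text \<open>An interval is contractible, so a continuous function without zeros on it has a
  continuous logarithm, whose imaginary part is the angle. Differentiability is local: for
  \<open>t\<close> near \<open>s\<close> the angle differs from \<open>g s\<close> by the principal
  argument of \<open>f t / f s\<close>, which is close to 1 and so off the branch cut.\<close>

lemma circle_lift:
  fixes f :: "real \<Rightarrow> complex"
  assumes "open I" "is_interval I"
    and norm: "\<And>s. s \<in> I \<Longrightarrow> norm (f s) = 1"
    and diff: "\<And>s. s \<in> I \<Longrightarrow> f differentiable (at s)"
  obtains g where "\<And>s. s \<in> I \<Longrightarrow> f s = cis (g s)" "g differentiable_on I"
proof -
  have cont: "continuous_on I f"
    using diff differentiable_imp_continuous_within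
    by (meson continuous_at_imp_continuous_on)
  have "contractible I"
    using assms(2) is_interval_convex_1 convex_imp_contractible by blast
  moreover have "f s \<noteq> 0" if "s \<in> I" for s
    using norm[OF that] by auto
  ultimately obtain h where h: "continuous_on I h" "\<And>s. s \<in> I \<Longrightarrow> f s = exp (h s)"
    using continuous_logarithm_on_contractible[OF cont] by blast
  define g where "g s = Im (h s)" for s
  have g: "f s = cis (g s)" if "s \<in> I" for s
    using h(2)[OF that] norm[OF that] norm_exp_eq_Re[of "h s"]
    by (simp add: exp_eq_polar[of "h s"] g_def)
  have contg: "continuous_on I g"
    unfolding g_def using h(1) by (intro continuous_intros)
  have "g differentiable (at s)" if s: "s \<in> I" for s
  proof -
    have fs: "f s \<noteq> 0" using norm[OF s] by auto
    let ?L = "\<lambda>t. Im (Ln (f t / f s))"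
    have "(\<lambda>t. f t / f s) differentiable (at s)"
      using diff[OF s] by (intro derivative_intros) (use fs in auto)
    then obtain D where D: "((\<lambda>t. f t / f s) has_vector_derivative D) (at s)"
      using vector_derivative_works by blast
    have "(Ln has_field_derivative inverse (f s / f s)) (at (f s / f s))"
      using fs by (intro has_field_derivative_Ln) simp
    from field_vector_diff_chain_at[OF D this]
    have "((\<lambda>t. Ln (f t / f s)) has_vector_derivative D * inverse (f s / f s)) (at s)"
      by (simp add: o_def)
    then have "(?L has_vector_derivative Im (D * inverse (f s / f s))) (at s)"
      by (rule bounded_linear.has_vector_derivative[OF bounded_linear_Im])
    then have L: "((\<lambda>t. ?L t + g s) has_vector_derivative Im (D * inverse (f s / f s))) (at s)"
      by (simp add: has_vector_derivative_add_const)
    \<comment> \<open>By continuity \<open>g t - g s\<close> eventually lies strictly between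
      \<open>- pi\<close> and \<open>pi\<close>, where \<open>Ln\<close> inverts \<open>exp\<close>
      without adding a multiple of \<open>2 * pi\<close>. The filter \<open>nhds s\<close> also
      covers \<open>t = s\<close>, as the transfer of the derivative requires.\<close>
    have ev: "\<forall>\<^sub>F t in nhds s. ?L t + g s = g t"
    proof -
      have "isCont g s"
        using contg \<open>open I\<close> s by (simp add: continuous_on_eq_continuous_at)
      then have "(g \<longlongrightarrow> g s) (nhds s)"
        by (simp add: isCont_def tendsto_at_iff_tendsto_nhds)
      then have "\<forall>\<^sub>F t in nhds s. dist (g t) (g s) < pi"
        by (rule tendstoD) simp
      moreover have "\<forall>\<^sub>F t in nhds s. t \<in> I"
        using \<open>open I\<close> s by (rule eventually_nhds_in_open)
      ultimately show ?thesis
      proof eventually_elim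
        case (elim t)
        have "f t / f s = exp (\<i> * complex_of_real (g t - g s))"
          using g[OF s] g[OF elim(2)] by (simp add: cis_conv_exp right_diff_distrib exp_diff)
        moreover have "Ln (exp (\<i> * complex_of_real (g t - g s))) = \<i> * complex_of_real (g t - g s)"
          using elim(1) by (intro Ln_exp) (auto simp: dist_real_def)
        ultimately show ?case by simp
      qed
    qed
    have "((\<lambda>t. ?L t + g s) has_vector_derivative Im (D * inverse (f s / f s))) (at s)
        = (g has_vector_derivative Im (D * inverse (f s / f s))) (at s)"
      by (rule has_vector_derivative_cong_ev)
        (use eventually_mono[OF ev] eventually_nhds_x_imp_x[OF ev] in auto)
    with L show ?thesis
      by (auto intro: differentiableI_vector)
  qed
  then have "g differentiable_on I"
    by (simp add: differentiable_at_imp_differentiable_on)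
  with g show ?thesis by (rule that)
qed

section \<open>Cross products of orthonormal vectors in three dimensions\<close>

text \<open>Both \<open>cross3 x y\<close> and \<open>z\<close> are unit vectors, and their inner
  product is the determinant, hence 1. Their squared distance is therefore 1 - 2 + 1 = 0.\<close>

lemma cross3_of_orthonormal:
  fixes x y z :: "real ^ 3"
  assumes "norm x = 1" "norm y = 1" "norm z = 1" "x \<bullet> y = 0"
    and "det (vector [x, y, z]) = 1"
  shows "cross3 x y = z"
proof -
  let ?w = "cross3 x y"
  have w: "(norm ?w)\<^sup>2 = 1" using norm_cross[of x y] assms by simp
  have "z \<bullet> ?w = 1"
    using assms(5) dot_cross_det[of x y z] cross_triple[of x y z]
    by (simp add: inner_commute)
  then have "(norm (?w - z))\<^sup>2 = 0"
    using w assms(3) unfolding power2_norm_eq_inner norm_eq_1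
    by (simp add: algebra_simps inner_commute)
  then show ?thesis by simp
qed

text \<open>Lagrange's formula evaluates the iterated products \<open>cross3 y (cross3 x y)\<close>
  and \<open>cross3 x (cross3 x y)\<close>; the second one also needs antisymmetry.\<close>

lemma cross3_cyclic:
  fixes x y z :: "real ^ 3"
  assumes "norm x = 1" "norm y = 1" "x \<bullet> y = 0" and z: "cross3 x y = z"
  shows "cross3 y z = x" "cross3 z x = y"
  using Lagrange[of y x y] Lagrange[of x x y] cross_skew[of z x] assms(1-3)
  by (simp_all add: z[symmetric] norm_eq_1 inner_commute)

section \<open>Angle functions and the algebra of Euler angles\<close>

lemma angle_function:
  fixes a b :: "real \<Rightarrow> real"
  assumes I: "open I" "is_interval I"
    and ab: "\<And>s. s \<in> I \<Longrightarrow> (a s)\<^sup>2 + (b s)\<^sup>2 = 1"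
    and diff: "\<And>s. s \<in> I \<Longrightarrow> a differentiable (at s)" "\<And>s. s \<in> I \<Longrightarrow> b differentiable (at s)"
  obtains g where "\<And>s. s \<in> I \<Longrightarrow> a s = cos (g s)" "\<And>s. s \<in> I \<Longrightarrow> b s = sin (g s)"
    "g differentiable_on I"
proof -
  let ?f = "\<lambda>s. Complex (a s) (b s)"
  have "norm (?f s) = 1" if "s \<in> I" for s
    using ab[OF that] by (simp add: cmod_def)
  moreover have "?f differentiable (at s)" if "s \<in> I" for s
  proof -
    have "(?f has_vector_derivative Complex (deriv a s) (deriv b s)) (at s)"
      using diff[OF that]
      by (simp add: has_vector_derivative_complex_iff DERIV_deriv_iff_real_differentiable)
    then show ?thesis by (rule differentiableI_vector)
  qed
  ultimately obtain g where g: "\<And>s. s \<in> I \<Longrightarrow> ?f s = cis (g s)" "g differentiable_on I"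
    using circle_lift[OF I, of ?f] by blast
  show ?thesis
    by (rule that[of g]) (use g in \<open>auto simp: complex_eq_iff\<close>)
qed

text \<open>The letters \<open>t\<close>, \<open>f\<close>, \<open>p\<close> after \<open>c\<close>
  and \<open>s\<close> mark the cosine and sine of \<theta>, \<phi>, \<psi>. The equations
  \<open>n1\<close> to \<open>n3\<close> are the entries of N' = \<tau> B1, and \<open>c1\<close> to
  \<open>c3\<close> those of B2' = - \<sigma> B1, both modulo T. Combining the second and third
  entries with the coefficients \<open>cf\<close> and \<open>sf\<close> removes \<phi>. Each result
  is then known after multiplication by a cosine and by the matching sine, and the Pythagorean
  identity recovers it without any division, so \<open>ct = 0\<close> is allowed.\<close>

lemma euler_derivative_identities:
  fixes ct st cf sf cp sp t' f' p' \<tau> \<sigma> :: real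
  assumes sq: "ct\<^sup>2 + st\<^sup>2 = 1" "cf\<^sup>2 + sf\<^sup>2 = 1" "cp\<^sup>2 + sp\<^sup>2 = 1"
    and n1: "- st * cp * t' - ct * sp * p' = \<tau> * (ct * sp)"
    and n2: "sf * f' * sp - cf * cp * p' + cf * f' * st * cp + sf * ct * t' * cp - sf * st * sp * p'
              = \<tau> * (cf * cp + sf * st * sp)"
    and n3: "cf * f' * sp + sf * cp * p' - sf * f' * st * cp + cf * ct * t' * cp - cf * st * sp * p'
              = \<tau> * (- sf * cp + cf * st * sp)"
    and c1: "- ct * t' = - \<sigma> * (ct * sp)"
    and c2: "cf * f' * ct - sf * st * t' = - \<sigma> * (cf * cp + sf * st * sp)"
    and c3: "- sf * f' * ct - cf * st * t' = - \<sigma> * (- sf * cp + cf * st * sp)"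
  shows "t' = \<sigma> * sp" "f' * ct = - \<sigma> * cp" "\<tau> = - p' + f' * st"
proof -
  show "f' * ct = - \<sigma> * cp" using c2 c3 sq(2) by algebra
  have "st * t' = \<sigma> * (st * sp)" using c2 c3 sq(2) by algebra
  then show "t' = \<sigma> * sp" using c1 sq(1) by algebra
  have "f' * sp + ct * t' * cp - st * sp * p' = \<tau> * (st * sp)"
    using n2 n3 sq(2) by algebra
  with n1 have "\<tau> * sp = (- p' + f' * st) * sp"
    using sq(1) by algebra
  moreover have "\<tau> * cp = (- p' + f' * st) * cp"
    using n2 n3 sq(2) by algebra
  ultimately show "\<tau> = - p' + f' * st"
    using sq(3) by algebra
qed

text \<open>Here \<open>r\<close> stands for
  \<open>sqrt (\<kappa>\<^sup>2 + \<tau>\<^sup>2)\<close>. The three formulas are not automatic: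
  they fail, for instance, if \<open>r < 1\<close> and \<open>\<sigma> \<noteq> 0\<close>, because
  \<open>sin \<psi>\<close> cannot exceed 1. Since \<open>\<sigma>\<^sup>2 - t'\<^sup>2\<close> is
  the square of \<open>\<sigma> * cos \<psi>\<close>, the root is an absolute value; for
  \<open>\<sigma> \<noteq> 0\<close> the formula for \<open>t'\<close> fixes
  \<open>sin \<psi>\<close>, the one for \<open>f'\<close> is a sign condition, and the one for
  \<open>p'\<close> then fixes \<open>tan \<theta>\<close> unless
  \<open>cos \<psi> = 0\<close>.\<close>

lemma euler_derivative_iff:
  fixes \<theta> \<psi> t' f' p' \<tau> \<sigma> r :: real
  assumes t: "t' = \<sigma> * sin \<psi>" and f: "f' * cos \<theta> = - \<sigma> * cos \<psi>" and p: "\<tau> = - p' + f' * sin \<theta>"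
    and c: "cos \<theta> \<noteq> 0" and r: "0 < r"
  shows "t' = \<sigma> / r \<and>
         p' = - \<tau> - \<sigma> * (sqrt (\<sigma>\<^sup>2 - t'\<^sup>2) / r) \<and>
         f' = - sqrt (\<sigma>\<^sup>2 - t'\<^sup>2) / cos \<theta>
         \<longleftrightarrow> \<sigma> = 0 \<or> sin \<psi> = 1 / r \<and> 0 \<le> \<sigma> * cos \<psi> \<and> (cos \<psi> = 0 \<or> tan \<theta> = \<sigma> / r)"
proof -
  have "\<sigma>\<^sup>2 - t'\<^sup>2 = (\<sigma> * cos \<psi>)\<^sup>2"
    by (simp add: t power_mult_distrib cos_squared_eq algebra_simps)
  then have root: "sqrt (\<sigma>\<^sup>2 - t'\<^sup>2) = \<bar>\<sigma> * cos \<psi>\<bar>"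
    by simp
  have f': "f' = - (\<sigma> * cos \<psi>) / cos \<theta>"
    using f c by (simp add: field_simps)
  then have p': "p' = - \<tau> - \<sigma> * (cos \<psi> * tan \<theta>)"
    using p by (simp add: tan_def)
  show ?thesis
  proof (cases "\<sigma> = 0")
    case True
    then show ?thesis using t f' p' by simp
  next
    case False
    have "f' = - sqrt (\<sigma>\<^sup>2 - t'\<^sup>2) / cos \<theta> \<longleftrightarrow> 0 \<le> \<sigma> * cos \<psi>"
      using c unfolding root f' by (auto simp: field_simps)
    moreover have "t' = \<sigma> / r \<longleftrightarrow> sin \<psi> = 1 / r"
      using False mult_cancel_left[of \<sigma> "sin \<psi>" "1 / r"] by (simp add: t)
    \<comment> \<open>This equivalence needs the sign condition supplied by the formula for
      \<open>f'\<close>: it lets the root be replaced by \<open>\<sigma> * cos \<psi>\<close>, and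
      the difference of the two sides then factors.\<close>
    moreover have "p' = - \<tau> - \<sigma> * (sqrt (\<sigma>\<^sup>2 - t'\<^sup>2) / r) \<longleftrightarrow> cos \<psi> = 0 \<or> tan \<theta> = \<sigma> / r"
      if "0 \<le> \<sigma> * cos \<psi>"
    proof -
      have "- \<tau> - \<sigma> * (cos \<psi> * tan \<theta>) - (- \<tau> - \<sigma> * (\<sigma> * cos \<psi> / r))
          = \<sigma> * (cos \<psi> * (\<sigma> / r - tan \<theta>))"
        by (simp add: algebra_simps)
      then show ?thesis
        using False abs_of_nonneg[OF that] unfolding root p'
        by (metis eq_iff_diff_eq_0 mult_eq_0_iff)
    qed
    ultimately show ?thesis using False by blast
  qed
qed

text \<open>The last row and the first column determine the rest of a rotation matrix. By
  \<open>n = cross3 b c\<close> and \<open>b = cross3 c n\<close>, the remaining four entries solve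
  two linear systems, one for \<open>n $ 2\<close> and \<open>b $ 3\<close>, one for
  \<open>n $ 3\<close> and \<open>b $ 2\<close>. Both have determinant
  \<open>1 - (c $ 1)\<^sup>2 = (cos \<theta>)\<^sup>2\<close>, which is not 0.\<close>

lemma euler_complete:
  fixes n b c :: "real ^ 3"
  assumes orth: "norm n = 1" "norm b = 1" "n \<bullet> b = 0" and c: "cross3 n b = c"
    and ct: "cos \<theta> \<noteq> 0"
    and eqs: "c $ 1 = - sin \<theta>" "c $ 2 = sin \<phi> * cos \<theta>" "c $ 3 = cos \<phi> * cos \<theta>"
      "n $ 1 = cos \<theta> * cos \<psi>" "b $ 1 = cos \<theta> * sin \<psi>"
  shows "n $ 2 = - cos \<phi> * sin \<psi> + sin \<phi> * sin \<theta> * cos \<psi>"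
    "n $ 3 = sin \<phi> * sin \<psi> + cos \<phi> * sin \<theta> * cos \<psi>"
    "b $ 2 = cos \<phi> * cos \<psi> + sin \<phi> * sin \<theta> * sin \<psi>"
    "b $ 3 = - sin \<phi> * cos \<psi> + cos \<phi> * sin \<theta> * sin \<psi>"
proof -
  have *: "n $ 2 = b $ 3 * c $ 1 - c $ 3 * b $ 1" "n $ 3 = b $ 1 * c $ 2 - c $ 1 * b $ 2"
    "b $ 2 = c $ 3 * n $ 1 - n $ 3 * c $ 1" "b $ 3 = c $ 1 * n $ 2 - n $ 1 * c $ 2"
    using cross_components[of b c] cross_components[of c n]
    unfolding cross3_cyclic[OF orth c] by blast+
  have "(cos \<theta>)\<^sup>2 + (sin \<theta>)\<^sup>2 = 1" by simp
  then have
    "(cos \<theta>)\<^sup>2 * n $ 2 = (cos \<theta>)\<^sup>2 * (- cos \<phi> * sin \<psi> + sin \<phi> * sin \<theta> * cos \<psi>)"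
    "(cos \<theta>)\<^sup>2 * n $ 3 = (cos \<theta>)\<^sup>2 * (sin \<phi> * sin \<psi> + cos \<phi> * sin \<theta> * cos \<psi>)"
    "(cos \<theta>)\<^sup>2 * b $ 2 = (cos \<theta>)\<^sup>2 * (cos \<phi> * cos \<psi> + sin \<phi> * sin \<theta> * sin \<psi>)"
    "(cos \<theta>)\<^sup>2 * b $ 3 = (cos \<theta>)\<^sup>2 * (- sin \<phi> * cos \<psi> + cos \<phi> * sin \<theta> * sin \<psi>)"
    using * eqs by algebra+
  then show "n $ 2 = - cos \<phi> * sin \<psi> + sin \<phi> * sin \<theta> * cos \<psi>"
    "n $ 3 = sin \<phi> * sin \<psi> + cos \<phi> * sin \<theta> * cos \<psi>"
    "b $ 2 = cos \<phi> * cos \<psi> + sin \<phi> * sin \<theta> * sin \<psi>"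
    "b $ 3 = - sin \<phi> * cos \<psi> + cos \<phi> * sin \<theta> * sin \<psi>"
    using ct by simp_all
qed

section \<open>Coordinates of normal vectors\<close>

text \<open>Dropping the component along the common tangent moves the normal space into
  \<open>real ^ 3\<close>, where \<open>cross3\<close> is available.\<close>

definition coords3 :: "E4 \<Rightarrow> E4 \<Rightarrow> E4 \<Rightarrow> E4 \<Rightarrow> real ^ 3" where
  "coords3 m1 m2 m3 x = vector [x \<bullet> m1, x \<bullet> m2, x \<bullet> m3]"

lemma coords3_nth [simp]:
  "coords3 m1 m2 m3 x $ 1 = x \<bullet> m1" "coords3 m1 m2 m3 x $ 2 = x \<bullet> m2"
  "coords3 m1 m2 m3 x $ 3 = x \<bullet> m3"
  by (simp_all add: coords3_def)

lemma coords3_inner_eq: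
  "coords3 m1 m2 m3 x \<bullet> coords3 m1 m2 m3 y =
     (x \<bullet> m1) * (y \<bullet> m1) + (x \<bullet> m2) * (y \<bullet> m2) + (x \<bullet> m3) * (y \<bullet> m3)"
  by (simp add: inner_vec_def[of "coords3 m1 m2 m3 x"] sum_3)

text \<open>When \<open>y\<close> is expanded in the frame, its \<open>t\<close> component
  contributes nothing because \<open>x\<close> is normal to \<open>t\<close>. On the normal space
  \<open>coords3\<close> is thus an isometry.\<close>

lemma coords3_inner:
  assumes "orthonormal4 t m1 m2 m3" "x \<bullet> t = 0"
  shows "coords3 m1 m2 m3 x \<bullet> coords3 m1 m2 m3 y = x \<bullet> y"
proof -
  have "x \<bullet> y = x \<bullet> ((y \<bullet> t) *\<^sub>R t + (y \<bullet> m1) *\<^sub>R m1 + (y \<bullet> m2) *\<^sub>R m2 + (y \<bullet> m3) *\<^sub>R m3)"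
    using orthonormal4_expand[OF assms(1), of y] by simp
  also have "\<dots> = coords3 m1 m2 m3 x \<bullet> coords3 m1 m2 m3 y"
    using assms(2) by (simp add: inner_add_right coords3_inner_eq mult.commute)
  finally show ?thesis ..
qed

lemma coords3_frame:
  assumes n: "orthonormal4 t n b c" and m: "orthonormal4 t m1 m2 m3"
  shows "norm (coords3 m1 m2 m3 n) = 1" "norm (coords3 m1 m2 m3 b) = 1"
    "norm (coords3 m1 m2 m3 c) = 1" "coords3 m1 m2 m3 n \<bullet> coords3 m1 m2 m3 b = 0"
proof -
  have nm: "n \<bullet> t = 0" "b \<bullet> t = 0" "c \<bullet> t = 0" "n \<bullet> n = 1" "b \<bullet> b = 1" "c \<bullet> c = 1" "n \<bullet> b = 0"
    using n by (auto simp: orthonormal4_def norm_eq_1 inner_commute)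
  then show "norm (coords3 m1 m2 m3 n) = 1" "norm (coords3 m1 m2 m3 b) = 1"
    "norm (coords3 m1 m2 m3 c) = 1" "coords3 m1 m2 m3 n \<bullet> coords3 m1 m2 m3 b = 0"
    by (simp_all add: norm_eq_1 coords3_inner[OF m])
qed

text \<open>Each frame has determinant 1 or -1, so a positive product equals 1. That product is the
  determinant of the inner products between the frames, whose first row is
  \<open>(1, 0, 0, 0)\<close>; hence the 3 by 3 matrix of coordinates has determinant 1 as
  well.\<close>

lemma same_orientation_imp_cross3:
  assumes n: "orthonormal4 t n b c" and m: "orthonormal4 t m1 m2 m3"
    and "same_orientation t n b c t m1 m2 m3"
  shows "cross3 (coords3 m1 m2 m3 n) (coords3 m1 m2 m3 b) = coords3 m1 m2 m3 c"
proof -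
  let ?A = "vector [t, n, b, c] :: real ^ 4 ^ 4"
  let ?B = "vector [t, m1, m2, m3] :: real ^ 4 ^ 4"
  let ?k = "coords3 m1 m2 m3"
  have nm: "t \<bullet> t = 1" "n \<bullet> t = 0" "b \<bullet> t = 0" "c \<bullet> t = 0" "t \<bullet> m1 = 0" "t \<bullet> m2 = 0" "t \<bullet> m3 = 0"
      "n \<bullet> n = 1" "b \<bullet> b = 1" "c \<bullet> c = 1" "n \<bullet> b = 0"
    using n m by (auto simp: orthonormal4_def norm_eq_1 inner_commute)
  have "det ?A * det ?B = 1"
    using assms(3) det_orthogonal_matrix[OF orthonormal4_matrix[OF n]]
      det_orthogonal_matrix[OF orthonormal4_matrix[OF m]]
    by (auto simp: same_orientation_def)
  then have "det (?A ** transpose ?B) = 1"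
    by (simp add: det_mul)
  moreover have entry: "(?A ** transpose ?B) $ i $ j = (?A $ i) \<bullet> (?B $ j)" for i j
    by (simp add: matrix_matrix_mult_def transpose_def inner_vec_def)
  ultimately have "det (vector [?k n, ?k b, ?k c]) = 1"
    using nm by (subst (asm) det_4_first_row) (simp_all add: det_3)
  then show ?thesis
    by (intro cross3_of_orthonormal coords3_frame[OF n m])
qed

lemma related_by_angles_iff:
  assumes n: "orthonormal4 t n b c" and m: "orthonormal4 t m1 m2 m3"
  shows "related_by_angles \<theta> \<phi> \<psi> n b c m1 m2 m3 \<longleftrightarrow>
     n \<bullet> m1 = cos \<theta> * cos \<psi> \<and>
     n \<bullet> m2 = - cos \<phi> * sin \<psi> + sin \<phi> * sin \<theta> * cos \<psi> \<and>
     n \<bullet> m3 = sin \<phi> * sin \<psi> + cos \<phi> * sin \<theta> * cos \<psi> \<and>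
     b \<bullet> m1 = cos \<theta> * sin \<psi> \<and>
     b \<bullet> m2 = cos \<phi> * cos \<psi> + sin \<phi> * sin \<theta> * sin \<psi> \<and>
     b \<bullet> m3 = - sin \<phi> * cos \<psi> + cos \<phi> * sin \<theta> * sin \<psi> \<and>
     c \<bullet> m1 = - sin \<theta> \<and> c \<bullet> m2 = sin \<phi> * cos \<theta> \<and> c \<bullet> m3 = cos \<phi> * cos \<theta>"
proof -
  have "x = p *\<^sub>R m1 + q *\<^sub>R m2 + r *\<^sub>R m3 \<longleftrightarrow> x \<bullet> m1 = p \<and> x \<bullet> m2 = q \<and> x \<bullet> m3 = r"
    if "x \<bullet> t = 0" for x p q r
  proof
    show "x \<bullet> m1 = p \<and> x \<bullet> m2 = q \<and> x \<bullet> m3 = r" if "x = p *\<^sub>R m1 + q *\<^sub>R m2 + r *\<^sub>R m3"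
      using m unfolding that
      by (auto simp: orthonormal4_def norm_eq_1 inner_add_left inner_add_right inner_commute)
    show "x = p *\<^sub>R m1 + q *\<^sub>R m2 + r *\<^sub>R m3" if "x \<bullet> m1 = p \<and> x \<bullet> m2 = q \<and> x \<bullet> m3 = r"
      using orthonormal4_expand[OF m, of x] that \<open>x \<bullet> t = 0\<close> by auto
  qed
  moreover have "n \<bullet> t = 0" "b \<bullet> t = 0" "c \<bullet> t = 0"
    using n by (auto simp: orthonormal4_def inner_commute)
  ultimately show ?thesis
    by (simp only: related_by_angles_def conj_assoc)
qed

lemma last_row_unit:
  assumes n: "orthonormal4 t n b c" and m: "orthonormal4 t m1 m2 m3"
  shows "(c \<bullet> m1)\<^sup>2 + (c \<bullet> m2)\<^sup>2 + (c \<bullet> m3)\<^sup>2 = 1"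
  using coords3_frame(3)[OF n m] by (simp add: norm_eq_1 coords3_inner_eq power2_eq_square)

text \<open>For \<open>x\<close> among \<open>m1\<close>, \<open>m2\<close>, \<open>m3\<close> this
  concerns a column of the coordinate matrix. It is the isometry \<open>coords3_inner\<close> with
  \<open>n\<close>, \<open>b\<close>, \<open>c\<close> as the reference frame.\<close>

lemma column_unit:
  assumes n: "orthonormal4 t n b c" and x: "x \<bullet> t = 0" "norm x = 1"
  shows "(n \<bullet> x)\<^sup>2 + (b \<bullet> x)\<^sup>2 + (c \<bullet> x)\<^sup>2 = 1"
  using coords3_inner[OF n x(1), of x] x(2)
  by (simp add: norm_eq_1 coords3_inner_eq power2_eq_square inner_commute)

section \<open>Existence of Euler angles at one point\<close>

context
  fixes t n b c m1 m2 m3 :: E4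
  assumes n: "orthonormal4 t n b c" and m: "orthonormal4 t m1 m2 m3"
    and orient: "same_orientation t n b c t m1 m2 m3"
begin

lemma related_by_anglesI:
  assumes "cos \<theta> \<noteq> 0" "c \<bullet> m1 = - sin \<theta>" "c \<bullet> m2 = sin \<phi> * cos \<theta>" "c \<bullet> m3 = cos \<phi> * cos \<theta>"
    "n \<bullet> m1 = cos \<theta> * cos \<psi>" "b \<bullet> m1 = cos \<theta> * sin \<psi>"
  shows "related_by_angles \<theta> \<phi> \<psi> n b c m1 m2 m3"
proof -
  have "n \<bullet> m2 = - cos \<phi> * sin \<psi> + sin \<phi> * sin \<theta> * cos \<psi> \<and>
    n \<bullet> m3 = sin \<phi> * sin \<psi> + cos \<phi> * sin \<theta> * cos \<psi> \<and>
    b \<bullet> m2 = cos \<phi> * cos \<psi> + sin \<phi> * sin \<theta> * sin \<psi> \<and>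
    b \<bullet> m3 = - sin \<phi> * cos \<psi> + cos \<phi> * sin \<theta> * sin \<psi>"
    using euler_complete[OF coords3_frame(1,2,4)[OF n m] same_orientation_imp_cross3[OF n m orient] assms(1),
        of \<phi> \<psi>] assms
    by simp
  then show ?thesis
    unfolding related_by_angles_iff[OF n m] using assms by simp
qed

lemma related_by_angles_exists: "\<exists>\<theta> \<phi> \<psi>. related_by_angles \<theta> \<phi> \<psi> n b c m1 m2 m3"
proof -
  define S where "S = - (c \<bullet> m1)"
  define \<theta> where "\<theta> = arcsin S"
  have row: "S\<^sup>2 + (c \<bullet> m2)\<^sup>2 + (c \<bullet> m3)\<^sup>2 = 1"
    using last_row_unit[OF n m] by (simp add: S_def)
  have m1: "m1 \<bullet> t = 0" "norm m1 = 1" and m2: "m2 \<bullet> t = 0" "norm m2 = 1"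
    using m by (auto simp: orthonormal4_def inner_commute)
  have col1: "(n \<bullet> m1)\<^sup>2 + (b \<bullet> m1)\<^sup>2 + S\<^sup>2 = 1"
    using column_unit[OF n m1] by (simp add: S_def)
  have S1: "\<bar>S\<bar> \<le> 1"
    using row by (simp flip: abs_square_le_1) (smt (verit) zero_le_power2)
  then have sin: "sin \<theta> = S"
    by (simp add: \<theta>_def abs_le_iff)
  show ?thesis
  proof (cases "cos \<theta> = 0")
    case False
    have ct: "(cos \<theta>)\<^sup>2 = 1 - S\<^sup>2"
      by (simp add: cos_squared_eq sin)
    with False have S_neq: "S\<^sup>2 \<noteq> 1" by auto
    \<comment> \<open>Divided by \<open>cos \<theta>\<close>, the rest of the last row becomes a
      point of the unit circle and yields \<phi>; the rest of the first column yields \<psi> in the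
      same way.\<close>
    have "((c \<bullet> m3) / cos \<theta>)\<^sup>2 + ((c \<bullet> m2) / cos \<theta>)\<^sup>2 = 1"
      using row S_neq ct by (simp add: power_divide divide_eq_1_iff flip: add_divide_distrib)
    then obtain \<phi> where \<phi>: "(c \<bullet> m3) / cos \<theta> = cos \<phi>" "(c \<bullet> m2) / cos \<theta> = sin \<phi>"
      by (rule sincos_total_2pi)
    have "((n \<bullet> m1) / cos \<theta>)\<^sup>2 + ((b \<bullet> m1) / cos \<theta>)\<^sup>2 = 1"
      using col1 S_neq ct by (simp add: power_divide divide_eq_1_iff flip: add_divide_distrib)
    then obtain \<psi> where \<psi>: "(n \<bullet> m1) / cos \<theta> = cos \<psi>" "(b \<bullet> m1) / cos \<theta> = sin \<psi>"
      by (rule sincos_total_2pi)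
    have "related_by_angles \<theta> \<phi> \<psi> n b c m1 m2 m3"
      using False \<phi> \<psi> sin by (intro related_by_anglesI) (auto simp: S_def field_simps)
    then show ?thesis by blast
  next
    \<comment> \<open>Gimbal lock: \<open>c\<close> is \<open>m1\<close> or \<open>- m1\<close>, and
      only one combination of \<phi> and \<psi> is determined. The choice is
      \<open>\<phi> = 0\<close>, with \<psi> read off from the column of \<open>m2\<close>.\<close>
    case True
    then have S2: "S\<^sup>2 = 1"
      using sin_cos_squared_add[of \<theta>] by (simp add: sin)
    then have z: "c \<bullet> m2 = 0" "c \<bullet> m3 = 0" "n \<bullet> m1 = 0" "b \<bullet> m1 = 0"
      using row col1 by (simp_all add: add_nonneg_eq_0_iff)
    have "(b \<bullet> m2)\<^sup>2 + (- (n \<bullet> m2))\<^sup>2 = 1"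
      using column_unit[OF n m2] z by simp
    then obtain \<psi> where \<psi>: "b \<bullet> m2 = cos \<psi>" "- (n \<bullet> m2) = sin \<psi>"
      by (rule sincos_total_2pi)
    let ?k = "coords3 m1 m2 m3"
    have cr: "cross3 (?k n) (?k b) = ?k c"
      by (rule same_orientation_imp_cross3[OF n m orient])
    \<comment> \<open>The third components of these products express the column of \<open>m3\<close>
      through that of \<open>m2\<close>, with the sign \<open>S\<close>.\<close>
    have "cross3 (?k b) (?k c) = ?k n" "cross3 (?k c) (?k n) = ?k b"
      using cross3_cyclic[OF coords3_frame(1,2,4)[OF n m] cr] by simp_all
    then have "n \<bullet> m3 = S * cos \<psi>" "b \<bullet> m3 = S * sin \<psi>"
      using cross_components(3)[of "?k b" "?k c"] cross_components(3)[of "?k c" "?k n"] z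
      by (simp_all add: S_def flip: \<psi>)
    then have "related_by_angles \<theta> 0 \<psi> n b c m1 m2 m3"
      unfolding related_by_angles_iff[OF n m] using True sin z \<psi> by (simp add: S_def)
    then show ?thesis by blast
  qed
qed

end

section \<open>Derivatives along the curve\<close>

lemma has_real_derivative_inner:
  fixes f g :: "real \<Rightarrow> 'a::real_inner"
  assumes "(f has_vector_derivative f') (at s)" "(g has_vector_derivative g') (at s)"
  shows "((\<lambda>u. f u \<bullet> g u) has_real_derivative f s \<bullet> g' + f' \<bullet> g s) (at s)"
  using bounded_bilinear.has_vector_derivative[OF bounded_bilinear_inner assms]
  by (simp add: has_real_derivative_iff_has_vector_derivative)

text \<open>The definition only provides some factor \<open>c\<close> with M' = c T. Differentiating
  the constant inner product of M and T identifies it as minus the inner product of T' and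
  M.\<close>

lemma relatively_parallel_derivative:
  assumes "open I" "s \<in> I" and M: "relatively_parallel I T M"
    and T: "(T has_vector_derivative T') (at s)" "norm (T s) = 1"
  shows "(M has_vector_derivative - (T' \<bullet> M s) *\<^sub>R T s) (at s)"
proof -
  from M \<open>s \<in> I\<close> obtain c where c: "(M has_vector_derivative c *\<^sub>R T s) (at s)"
    by (auto simp: relatively_parallel_def)
  have "((\<lambda>u. M u \<bullet> T u) has_real_derivative M s \<bullet> T' + c) (at s)"
    using has_real_derivative_inner[OF c T(1)] T(2) by (simp add: norm_eq_1)
  moreover have "((\<lambda>u. M u \<bullet> T u) has_real_derivative 0) (at s)"
    by (rule has_field_derivative_transform_within_open[OF DERIV_const[of 0] \<open>open I\<close> \<open>s \<in> I\<close>])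
      (use M in \<open>auto simp: relatively_parallel_def\<close>)
  ultimately have "M s \<bullet> T' + c = 0" by (rule DERIV_unique)
  with c show ?thesis
    by (metis add_eq_0_iff inner_commute)
qed

text \<open>The derivative of \<open>M\<close> is tangential and hence orthogonal to
  \<open>N\<close>, \<open>B1\<close> and \<open>B2\<close>, while the T term of N' is orthogonal to
  \<open>M\<close>. Only the normal part of the Frenet equations survives.\<close>

lemma frenet_coordinate_derivatives:
  assumes F: "frenet_frame I \<alpha> T N B1 B2 \<kappa> \<tau> \<sigma>" and M: "relatively_parallel I T M" and s: "s \<in> I"
  shows "((\<lambda>u. N u \<bullet> M u) has_real_derivative \<tau> s * (B1 s \<bullet> M s)) (at s)"
    "((\<lambda>u. B1 u \<bullet> M u) has_real_derivative - \<tau> s * (N s \<bullet> M s) + \<sigma> s * (B2 s \<bullet> M s)) (at s)"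
    "((\<lambda>u. B2 u \<bullet> M u) has_real_derivative - \<sigma> s * (B1 s \<bullet> M s)) (at s)"
proof -
  from M s obtain c where c: "(M has_vector_derivative c *\<^sub>R T s) (at s)" and MT: "M s \<bullet> T s = 0"
    by (auto simp: relatively_parallel_def)
  have F': "orthonormal4 (T s) (N s) (B1 s) (B2 s)"
    "(N has_vector_derivative - \<kappa> s *\<^sub>R T s + \<tau> s *\<^sub>R B1 s) (at s)"
    "(B1 has_vector_derivative - \<tau> s *\<^sub>R N s + \<sigma> s *\<^sub>R B2 s) (at s)"
    "(B2 has_vector_derivative - \<sigma> s *\<^sub>R B1 s) (at s)"
    using F s by (auto simp: frenet_frame_def)
  have o: "N s \<bullet> T s = 0" "B1 s \<bullet> T s = 0" "B2 s \<bullet> T s = 0" "T s \<bullet> M s = 0"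
    using F'(1) MT by (auto simp: orthonormal4_def inner_commute)
  show "((\<lambda>u. N u \<bullet> M u) has_real_derivative \<tau> s * (B1 s \<bullet> M s)) (at s)"
    "((\<lambda>u. B1 u \<bullet> M u) has_real_derivative - \<tau> s * (N s \<bullet> M s) + \<sigma> s * (B2 s \<bullet> M s)) (at s)"
    "((\<lambda>u. B2 u \<bullet> M u) has_real_derivative - \<sigma> s * (B1 s \<bullet> M s)) (at s)"
    using F'(2-4)[THEN has_real_derivative_inner, OF c] o by (simp_all add: inner_add_left inner_diff_left)
qed

text \<open>The squared norms of \<open>x - y\<close> and \<open>x + y\<close> are 2 minus and 2
  plus twice the inner product, and both are positive.\<close>

lemma abs_inner_lt_1:
  fixes x y :: "'a::real_inner"
  assumes "norm x = 1" "norm y = 1" "x \<noteq> y" "x \<noteq> - y"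
  shows "\<bar>x \<bullet> y\<bar> < 1"
proof -
  have "0 < (norm (x - y))\<^sup>2" "0 < (norm (x + y))\<^sup>2"
    using assms(3,4) by (auto simp: add_eq_0_iff)
  then show ?thesis
    using assms(1,2) by (simp add: power2_norm_eq_inner norm_eq_1 algebra_simps inner_commute)
qed

section \<open>The two frames along the curve\<close>

theorem theorem1:
  fixes I :: "real set"
    and \<alpha> T N B1 B2 M1 M2 M3 :: "real \<Rightarrow> E4"
    and \<kappa> \<tau> \<sigma> k1 k2 k3 :: "real \<Rightarrow> real"
  assumes "open I" and "is_interval I"
    and "unit_speed_curve I \<alpha>"
    and "frenet_frame I \<alpha> T N B1 B2 \<kappa> \<tau> \<sigma>"
    and "parallel_transport_frame I \<alpha> T M1 M2 M3"
    and "\<forall>s\<in>I. same_orientation (T s) (N s) (B1 s) (B2 s) (T s) (M1 s) (M2 s) (M3 s)"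
    and "\<forall>s\<in>I. k1 s = vector_derivative T (at s) \<bullet> M1 s"
    and "\<forall>s\<in>I. k2 s = vector_derivative T (at s) \<bullet> M2 s"
    and "\<forall>s\<in>I. k3 s = vector_derivative T (at s) \<bullet> M3 s"
  shows
    "(\<exists>\<theta> \<phi> \<psi> :: real \<Rightarrow> real.
        (\<forall>s\<in>I. related_by_angles (\<theta> s) (\<phi> s) (\<psi> s) (N s) (B1 s) (B2 s) (M1 s) (M2 s) (M3 s)) \<and>
        ((\<forall>s\<in>I. B2 s \<noteq> M1 s \<and> B2 s \<noteq> - M1 s) \<longrightarrow>
           \<theta> differentiable_on I \<and> \<phi> differentiable_on I \<and> \<psi> differentiable_on I)) \<and>
     (\<forall>s\<in>I.
        (T has_vector_derivative k1 s *\<^sub>R M1 s + k2 s *\<^sub>R M2 s + k3 s *\<^sub>R M3 s) (at s) \<and>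
        (M1 has_vector_derivative - k1 s *\<^sub>R T s) (at s) \<and>
        (M2 has_vector_derivative - k2 s *\<^sub>R T s) (at s) \<and>
        (M3 has_vector_derivative - k3 s *\<^sub>R T s) (at s) \<and>
        \<kappa> s = sqrt ((k1 s)\<^sup>2 + (k2 s)\<^sup>2 + (k3 s)\<^sup>2)) \<and>
     (\<forall>\<theta> \<phi> \<psi> :: real \<Rightarrow> real.
        (\<forall>s\<in>I. related_by_angles (\<theta> s) (\<phi> s) (\<psi> s) (N s) (B1 s) (B2 s) (M1 s) (M2 s) (M3 s)) \<longrightarrow>
        (\<forall>s\<in>I.
           k1 s = \<kappa> s * (cos (\<theta> s) * cos (\<psi> s)) \<and>
           k2 s = \<kappa> s * (- cos (\<phi> s) * sin (\<psi> s) + sin (\<phi> s) * sin (\<theta> s) * cos (\<psi> s)) \<and>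
           k3 s = \<kappa> s * (sin (\<phi> s) * sin (\<psi> s) + cos (\<phi> s) * sin (\<theta> s) * cos (\<psi> s))) \<and>
        (\<theta> differentiable_on I \<and> \<phi> differentiable_on I \<and> \<psi> differentiable_on I \<longrightarrow>
         (\<forall>s\<in>I.
            \<tau> s = - deriv \<psi> s + deriv \<phi> s * sin (\<theta> s) \<and>
            (sin (\<psi> s) \<noteq> 0 \<longrightarrow>
               \<sigma> s = deriv \<theta> s / sin (\<psi> s) \<and>
               deriv \<phi> s * cos (\<theta> s) + deriv \<theta> s * cot (\<psi> s) = 0) \<and>
            (cos (\<theta> s) \<noteq> 0 \<longrightarrow>
               (deriv \<theta> s = \<sigma> s / sqrt ((\<kappa> s)\<^sup>2 + (\<tau> s)\<^sup>2) \<and>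
                deriv \<psi> s = - \<tau> s - \<sigma> s * (sqrt ((\<sigma> s)\<^sup>2 - (deriv \<theta> s)\<^sup>2) / sqrt ((\<kappa> s)\<^sup>2 + (\<tau> s)\<^sup>2)) \<and>
                deriv \<phi> s = - sqrt ((\<sigma> s)\<^sup>2 - (deriv \<theta> s)\<^sup>2) / cos (\<theta> s)
                \<longleftrightarrow>
                \<sigma> s = 0 \<or>
                sin (\<psi> s) = 1 / sqrt ((\<kappa> s)\<^sup>2 + (\<tau> s)\<^sup>2) \<and>
                0 \<le> \<sigma> s * cos (\<psi> s) \<and>
                (cos (\<psi> s) = 0 \<or> tan (\<theta> s) = \<sigma> s / sqrt ((\<kappa> s)\<^sup>2 + (\<tau> s)\<^sup>2)))))))"
proof -
  note I = \<open>open I\<close> \<open>is_interval I\<close>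
  note F = \<open>frenet_frame I \<alpha> T N B1 B2 \<kappa> \<tau> \<sigma>\<close>
  note P = \<open>parallel_transport_frame I \<alpha> T M1 M2 M3\<close>
  have n: "orthonormal4 (T s) (N s) (B1 s) (B2 s)" and \<kappa>: "0 < \<kappa> s"
    and T': "(T has_vector_derivative \<kappa> s *\<^sub>R N s) (at s)" if "s \<in> I" for s
    using F that by (auto simp: frenet_frame_def)
  have m: "orthonormal4 (T s) (M1 s) (M2 s) (M3 s)" if "s \<in> I" for s
    using P that by (auto simp: parallel_transport_frame_def)
  have rp: "relatively_parallel I T M1" "relatively_parallel I T M2" "relatively_parallel I T M3"
    using P by (auto simp: parallel_transport_frame_def)
  note orient = bspec[OF assms(6)]
  note D1 = frenet_coordinate_derivatives[OF F rp(1)]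
    and D2 = frenet_coordinate_derivatives[OF F rp(2)]
    and D3 = frenet_coordinate_derivatives[OF F rp(3)]
  have k: "k1 s = \<kappa> s * (N s \<bullet> M1 s)" "k2 s = \<kappa> s * (N s \<bullet> M2 s)" "k3 s = \<kappa> s * (N s \<bullet> M3 s)"
    if "s \<in> I" for s
    using assms(7-9) that vector_derivative_at[OF T'[OF that]] by simp_all
  note rel_iff = related_by_angles_iff[OF n m]

  have "\<exists>\<theta> \<phi> \<psi> :: real \<Rightarrow> real.
        (\<forall>s\<in>I. related_by_angles (\<theta> s) (\<phi> s) (\<psi> s) (N s) (B1 s) (B2 s) (M1 s) (M2 s) (M3 s)) \<and>
        ((\<forall>s\<in>I. B2 s \<noteq> M1 s \<and> B2 s \<noteq> - M1 s) \<longrightarrow>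
           \<theta> differentiable_on I \<and> \<phi> differentiable_on I \<and> \<psi> differentiable_on I)"
  proof (cases "\<forall>s\<in>I. B2 s \<noteq> M1 s \<and> B2 s \<noteq> - M1 s")
    \<comment> \<open>Without the separation of \<open>B2\<close> from \<open>M1\<close> and
      \<open>- M1\<close> nothing is claimed about differentiability, so a pointwise choice of
      angles suffices.\<close>
    case False
    have "\<forall>s\<in>I. \<exists>\<theta> \<phi> \<psi>. related_by_angles \<theta> \<phi> \<psi> (N s) (B1 s) (B2 s) (M1 s) (M2 s) (M3 s)"
      using related_by_angles_exists[OF n m orient] by blast
    with False show ?thesis by metis
  next
    case True
    define \<theta> where "\<theta> s = arcsin (- (B2 s \<bullet> M1 s))" for s
    \<comment> \<open>Strictness matters twice: \<open>arcsin\<close> is differentiable inside the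
      open interval, and \<open>cos (\<theta> s)\<close> does not vanish.\<close>
    have lt1: "\<bar>B2 s \<bullet> M1 s\<bar> < 1" if "s \<in> I" for s
      using abs_inner_lt_1[of "B2 s" "M1 s"] True n[OF that] m[OF that] that
      by (auto simp: orthonormal4_def)
    have sin: "sin (\<theta> s) = - (B2 s \<bullet> M1 s)" if "s \<in> I" for s
      using lt1[OF that] unfolding \<theta>_def by (intro sin_arcsin) auto
    have ct: "(cos (\<theta> s))\<^sup>2 = 1 - (B2 s \<bullet> M1 s)\<^sup>2" if "s \<in> I" for s
      using sin[OF that] by (simp add: cos_squared_eq)
    have ct0: "cos (\<theta> s) \<noteq> 0" if "s \<in> I" for s
      using ct[OF that] lt1[OF that] abs_square_less_1[of "B2 s \<bullet> M1 s"] by auto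
    have d\<theta>: "\<theta> differentiable (at s)" if "s \<in> I" for s
    proof -
      have "((\<lambda>u. - (B2 u \<bullet> M1 u)) has_real_derivative - (- \<sigma> s * (B1 s \<bullet> M1 s))) (at s)"
        using D1(3)[OF that] by (rule DERIV_minus)
      with lt1[OF that] have "(\<theta> has_real_derivative
          inverse (sqrt (1 - (- (B2 s \<bullet> M1 s))\<^sup>2)) * - (- \<sigma> s * (B1 s \<bullet> M1 s))) (at s)"
        unfolding \<theta>_def[abs_def] by (intro DERIV_chain2[OF DERIV_arcsin]) auto
      then show ?thesis unfolding real_differentiable_def by blast
    qed
    have quot: "(\<lambda>u. f u / cos (\<theta> u)) differentiable (at s)"
      if "s \<in> I" "(f has_real_derivative D) (at s)" for f D s
    proof -
      have "(\<theta> has_real_derivative deriv \<theta> s) (at s)"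
        using d\<theta>[OF that(1)] by (simp add: DERIV_deriv_iff_real_differentiable)
      from DERIV_divide[OF that(2) DERIV_fun_cos[OF this] ct0[OF that(1)]]
      show ?thesis unfolding real_differentiable_def by (rule exI)
    qed
    have ct1: "(B2 s \<bullet> M1 s)\<^sup>2 \<noteq> 1" if "s \<in> I" for s
      using ct[OF that] ct0[OF that] by auto
    have row: "(B2 s \<bullet> M3 s / cos (\<theta> s))\<^sup>2 + (B2 s \<bullet> M2 s / cos (\<theta> s))\<^sup>2 = 1" if "s \<in> I" for s
      using last_row_unit[OF n m, OF that that] ct[OF that] ct1[OF that]
      by (simp add: power_divide divide_eq_1_iff flip: add_divide_distrib)
    obtain \<phi> where \<phi>: "\<And>s. s \<in> I \<Longrightarrow> B2 s \<bullet> M3 s / cos (\<theta> s) = cos (\<phi> s)"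
        "\<And>s. s \<in> I \<Longrightarrow> B2 s \<bullet> M2 s / cos (\<theta> s) = sin (\<phi> s)" "\<phi> differentiable_on I"
      using angle_function[OF I row quot[OF _ D3(3)] quot[OF _ D2(3)]] by blast
    have col: "(N s \<bullet> M1 s / cos (\<theta> s))\<^sup>2 + (B1 s \<bullet> M1 s / cos (\<theta> s))\<^sup>2 = 1" if "s \<in> I" for s
    proof -
      have "M1 s \<bullet> T s = 0" "norm (M1 s) = 1"
        using m[OF that] by (auto simp: orthonormal4_def inner_commute)
      then show ?thesis
        using column_unit[OF n[OF that], of "M1 s"] ct[OF that] ct1[OF that]
        by (simp add: power_divide divide_eq_1_iff flip: add_divide_distrib)
    qed
    obtain \<psi> where \<psi>: "\<And>s. s \<in> I \<Longrightarrow> N s \<bullet> M1 s / cos (\<theta> s) = cos (\<psi> s)"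
        "\<And>s. s \<in> I \<Longrightarrow> B1 s \<bullet> M1 s / cos (\<theta> s) = sin (\<psi> s)" "\<psi> differentiable_on I"
      using angle_function[OF I col quot[OF _ D1(1)] quot[OF _ D1(2)]] by blast
    have "related_by_angles (\<theta> s) (\<phi> s) (\<psi> s) (N s) (B1 s) (B2 s) (M1 s) (M2 s) (M3 s)"
      if "s \<in> I" for s
      using sin[OF that] ct0[OF that]
      by (intro related_by_anglesI[OF n m orient] that)
        (simp_all flip: \<phi>(1,2)[OF that] \<psi>(1,2)[OF that])
    moreover have "\<theta> differentiable_on I"
      using d\<theta> by (simp add: differentiable_at_imp_differentiable_on)
    ultimately show ?thesis using \<phi>(3) \<psi>(3) by blast
  qed

  moreover have "(T has_vector_derivative k1 s *\<^sub>R M1 s + k2 s *\<^sub>R M2 s + k3 s *\<^sub>R M3 s) (at s) \<and>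
        (M1 has_vector_derivative - k1 s *\<^sub>R T s) (at s) \<and>
        (M2 has_vector_derivative - k2 s *\<^sub>R T s) (at s) \<and>
        (M3 has_vector_derivative - k3 s *\<^sub>R T s) (at s) \<and>
        \<kappa> s = sqrt ((k1 s)\<^sup>2 + (k2 s)\<^sup>2 + (k3 s)\<^sup>2)" if s: "s \<in> I" for s
  proof -
    have o: "norm (T s) = 1" "N s \<bullet> T s = 0" "norm (N s) = 1"
      using n[OF s] by (auto simp: orthonormal4_def inner_commute)
    \<comment> \<open>Since \<open>N s\<close> is normal to \<open>T s\<close>, its expansion has no
      tangential term; scaling by \<open>\<kappa> s\<close> gives T', and the unit length of
      \<open>N s\<close> gives the formula for \<kappa>.\<close>
    have "N s = (N s \<bullet> M1 s) *\<^sub>R M1 s + (N s \<bullet> M2 s) *\<^sub>R M2 s + (N s \<bullet> M3 s) *\<^sub>R M3 s"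
      using orthonormal4_expand[OF m[OF s], of "N s"] o by simp
    from arg_cong[OF this, of "scaleR (\<kappa> s)"]
    have "\<kappa> s *\<^sub>R N s = k1 s *\<^sub>R M1 s + k2 s *\<^sub>R M2 s + k3 s *\<^sub>R M3 s"
      by (simp only: k[OF s] scaleR_right_distrib scaleR_scaleR)
    moreover have "(N s \<bullet> M1 s)\<^sup>2 + (N s \<bullet> M2 s)\<^sup>2 + (N s \<bullet> M3 s)\<^sup>2 = 1"
      using coords3_inner[OF m[OF s] o(2), of "N s"] o(3)
      by (simp add: coords3_inner_eq norm_eq_1 power2_eq_square)
    then have "(k1 s)\<^sup>2 + (k2 s)\<^sup>2 + (k3 s)\<^sup>2 = (\<kappa> s)\<^sup>2"
      unfolding k[OF s] power_mult_distrib by (simp flip: distrib_left)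
    moreover have "(M1 has_vector_derivative - k1 s *\<^sub>R T s) (at s)"
      "(M2 has_vector_derivative - k2 s *\<^sub>R T s) (at s)"
      "(M3 has_vector_derivative - k3 s *\<^sub>R T s) (at s)"
      using rp[THEN relatively_parallel_derivative[OF I(1) s _ T'[OF s] o(1)]]
      by (simp_all add: k[OF s])
    ultimately show ?thesis
      using T'[OF s] \<kappa>[OF s] by simp
  qed

  moreover have "k1 s = \<kappa> s * (cos (\<theta> s) * cos (\<psi> s)) \<and>
           k2 s = \<kappa> s * (- cos (\<phi> s) * sin (\<psi> s) + sin (\<phi> s) * sin (\<theta> s) * cos (\<psi> s)) \<and>
           k3 s = \<kappa> s * (sin (\<phi> s) * sin (\<psi> s) + cos (\<phi> s) * sin (\<theta> s) * cos (\<psi> s))"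
    if "\<forall>s\<in>I. related_by_angles (\<theta> s) (\<phi> s) (\<psi> s) (N s) (B1 s) (B2 s) (M1 s) (M2 s) (M3 s)" "s \<in> I"
    for \<theta> \<phi> \<psi> s
    using iffD1[OF rel_iff[OF that(2) that(2)] bspec[OF that]] k[OF that(2)] by simp

  moreover have "\<tau> s = - deriv \<psi> s + deriv \<phi> s * sin (\<theta> s) \<and>
            (sin (\<psi> s) \<noteq> 0 \<longrightarrow>
               \<sigma> s = deriv \<theta> s / sin (\<psi> s) \<and>
               deriv \<phi> s * cos (\<theta> s) + deriv \<theta> s * cot (\<psi> s) = 0) \<and>
            (cos (\<theta> s) \<noteq> 0 \<longrightarrow>
               (deriv \<theta> s = \<sigma> s / sqrt ((\<kappa> s)\<^sup>2 + (\<tau> s)\<^sup>2) \<and>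
                deriv \<psi> s = - \<tau> s - \<sigma> s * (sqrt ((\<sigma> s)\<^sup>2 - (deriv \<theta> s)\<^sup>2) / sqrt ((\<kappa> s)\<^sup>2 + (\<tau> s)\<^sup>2)) \<and>
                deriv \<phi> s = - sqrt ((\<sigma> s)\<^sup>2 - (deriv \<theta> s)\<^sup>2) / cos (\<theta> s)
                \<longleftrightarrow>
                \<sigma> s = 0 \<or>
                sin (\<psi> s) = 1 / sqrt ((\<kappa> s)\<^sup>2 + (\<tau> s)\<^sup>2) \<and>
                0 \<le> \<sigma> s * cos (\<psi> s) \<and>
                (cos (\<psi> s) = 0 \<or> tan (\<theta> s) = \<sigma> s / sqrt ((\<kappa> s)\<^sup>2 + (\<tau> s)\<^sup>2))))"
    if R: "\<forall>s\<in>I. related_by_angles (\<theta> s) (\<phi> s) (\<psi> s) (N s) (B1 s) (B2 s) (M1 s) (M2 s) (M3 s)"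
      and "\<theta> differentiable_on I" "\<phi> differentiable_on I" "\<psi> differentiable_on I" and s: "s \<in> I"
    for \<theta> \<phi> \<psi> s
  proof -
    have d: "(\<theta> has_real_derivative deriv \<theta> s) (at s)" "(\<phi> has_real_derivative deriv \<phi> s) (at s)"
      "(\<psi> has_real_derivative deriv \<psi> s) (at s)"
      using that by (auto simp: DERIV_deriv_iff_real_differentiable differentiable_on_def
          at_within_open[OF s I(1)])
    have rel: "N u \<bullet> M1 u = cos (\<theta> u) * cos (\<psi> u)"
      "N u \<bullet> M2 u = - cos (\<phi> u) * sin (\<psi> u) + sin (\<phi> u) * sin (\<theta> u) * cos (\<psi> u)"
      "N u \<bullet> M3 u = sin (\<phi> u) * sin (\<psi> u) + cos (\<phi> u) * sin (\<theta> u) * cos (\<psi> u)"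
      "B1 u \<bullet> M1 u = cos (\<theta> u) * sin (\<psi> u)"
      "B1 u \<bullet> M2 u = cos (\<phi> u) * cos (\<psi> u) + sin (\<phi> u) * sin (\<theta> u) * sin (\<psi> u)"
      "B1 u \<bullet> M3 u = - sin (\<phi> u) * cos (\<psi> u) + cos (\<phi> u) * sin (\<theta> u) * sin (\<psi> u)"
      "B2 u \<bullet> M1 u = - sin (\<theta> u)" "B2 u \<bullet> M2 u = sin (\<phi> u) * cos (\<theta> u)"
      "B2 u \<bullet> M3 u = cos (\<phi> u) * cos (\<theta> u)" if "u \<in> I" for u
      using iffD1[OF rel_iff[OF that that] bspec[OF R that]] by auto
    \<comment> \<open>A coordinate and its Euler expression agree on the open set \<open>I\<close>,
      so their derivatives at \<open>s\<close> agree. Here \<open>D\<close> comes from the Frenet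
      equations and \<open>E\<close> from differentiating the angles.\<close>
    have unique: "E = D"
      if "(f has_real_derivative D) (at s)" "\<And>u. u \<in> I \<Longrightarrow> f u = g u" "(g has_real_derivative E) (at s)"
      for f g :: "real \<Rightarrow> real" and D E
      using has_field_derivative_transform_within_open[OF that(1) I(1) s that(2)] that(3)
      by (metis DERIV_unique)
    have n1: "- sin (\<theta> s) * cos (\<psi> s) * deriv \<theta> s - cos (\<theta> s) * sin (\<psi> s) * deriv \<psi> s
        = \<tau> s * (cos (\<theta> s) * sin (\<psi> s))"
      by (rule unique[OF D1(1)[OF s, unfolded rel(4)[OF s]] rel(1)], assumption)
        (auto intro!: derivative_eq_intros d simp: algebra_simps)
    have n2: "sin (\<phi> s) * deriv \<phi> s * sin (\<psi> s) - cos (\<phi> s) * cos (\<psi> s) * deriv \<psi> s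
          + cos (\<phi> s) * deriv \<phi> s * sin (\<theta> s) * cos (\<psi> s)
          + sin (\<phi> s) * cos (\<theta> s) * deriv \<theta> s * cos (\<psi> s)
          - sin (\<phi> s) * sin (\<theta> s) * sin (\<psi> s) * deriv \<psi> s
        = \<tau> s * (cos (\<phi> s) * cos (\<psi> s) + sin (\<phi> s) * sin (\<theta> s) * sin (\<psi> s))"
      by (rule unique[OF D2(1)[OF s, unfolded rel(5)[OF s]] rel(2)], assumption)
        (auto intro!: derivative_eq_intros d simp: algebra_simps)
    have n3: "cos (\<phi> s) * deriv \<phi> s * sin (\<psi> s) + sin (\<phi> s) * cos (\<psi> s) * deriv \<psi> s
          - sin (\<phi> s) * deriv \<phi> s * sin (\<theta> s) * cos (\<psi> s)
          + cos (\<phi> s) * cos (\<theta> s) * deriv \<theta> s * cos (\<psi> s)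
          - cos (\<phi> s) * sin (\<theta> s) * sin (\<psi> s) * deriv \<psi> s
        = \<tau> s * (- sin (\<phi> s) * cos (\<psi> s) + cos (\<phi> s) * sin (\<theta> s) * sin (\<psi> s))"
      by (rule unique[OF D3(1)[OF s, unfolded rel(6)[OF s]] rel(3)], assumption)
        (auto intro!: derivative_eq_intros d simp: algebra_simps)
    have c1: "- cos (\<theta> s) * deriv \<theta> s = - \<sigma> s * (cos (\<theta> s) * sin (\<psi> s))"
      by (rule unique[OF D1(3)[OF s, unfolded rel(4)[OF s]] rel(7)], assumption)
        (auto intro!: derivative_eq_intros d simp: algebra_simps)
    have c2: "cos (\<phi> s) * deriv \<phi> s * cos (\<theta> s) - sin (\<phi> s) * sin (\<theta> s) * deriv \<theta> s
        = - \<sigma> s * (cos (\<phi> s) * cos (\<psi> s) + sin (\<phi> s) * sin (\<theta> s) * sin (\<psi> s))"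
      by (rule unique[OF D2(3)[OF s, unfolded rel(5)[OF s]] rel(8)], assumption)
        (auto intro!: derivative_eq_intros d simp: algebra_simps)
    have c3: "- sin (\<phi> s) * deriv \<phi> s * cos (\<theta> s) - cos (\<phi> s) * sin (\<theta> s) * deriv \<theta> s
        = - \<sigma> s * (- sin (\<phi> s) * cos (\<psi> s) + cos (\<phi> s) * sin (\<theta> s) * sin (\<psi> s))"
      by (rule unique[OF D3(3)[OF s, unfolded rel(6)[OF s]] rel(9)], assumption)
        (auto intro!: derivative_eq_intros d simp: algebra_simps)
    have t: "deriv \<theta> s = \<sigma> s * sin (\<psi> s)" and f: "deriv \<phi> s * cos (\<theta> s) = - \<sigma> s * cos (\<psi> s)"
      and p: "\<tau> s = - deriv \<psi> s + deriv \<phi> s * sin (\<theta> s)"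
      using euler_derivative_identities[OF _ _ _ n1 n2 n3 c1 c2 c3] by simp_all
    \<comment> \<open>Positivity of \<kappa> keeps the denominator away from 0 even where \<tau>
      vanishes.\<close>
    have "0 < sqrt ((\<kappa> s)\<^sup>2 + (\<tau> s)\<^sup>2)"
      using \<kappa>[OF s] by (simp add: add_pos_nonneg)
    from euler_derivative_iff[OF t f p _ this] p t f show ?thesis
      by (auto simp: cot_def)
  qed
  ultimately show ?thesis by blast
qed

end
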